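(* Let $p$ be a prime with $p > 32$. Then there is no polynomial $f \in \mathbb{F}_p[x]$ of degree exactly $\frac{p+1}{2}$ whose range sum equals $p$, i.e. such that $\sum_{x \in \mathbb{F}_p} f(x) = p$, where each value $f(x)$ is regarded as an integer in $\{0,1,\ldots,p-1\}$ and the sum is taken in $\mathbb{Z}$.
   Context: $\mathbb{F}_p$ denotes the field with $p$ elements, $p$ prime. Elements of $\mathbb{F}_p$ are identified with the integers $\{0,1,\ldots,p-1\}$; for $f \in \mathbb{F}_p[x]$, the range sum of $f$ is the integer $\sum_{x\in\mathbb{F}_p} f(x)$ computed in $\mathbb{Z}$ under this identification. *)

theory Defs
  imports "Berlekamp_Zassenhaus.Finite_Field"
begin

text \<open>
  The field with \<open>p\<close> elements is \<^typ>\<open>'p mod_ring\<close> with \<open>p = CARD('p)\<close> prime;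
  \<^const>\<open>to_int_mod_ring\<close> sends a residue class to its representative in \<open>{0..p - 1}\<close>,
  so the sum below is taken in the integers.
\<close>

definition range_sum :: "'p::prime_card mod_ring poly \<Rightarrow> int" where
  "range_sum f = (\<Sum>x\<in>UNIV. to_int_mod_ring (poly f x))"

end

theory Submission
  imports Defs "Berlekamp_Zassenhaus.Berlekamp_Type_Based"
begin

text \<open>
  Put \<open>Z = T^p - T\<close> and \<open>F = (\<Prod>x. (T - x)^f(x))\<close>, of degree \<open>p\<close> because the range sum is \<open>p\<close>.
  Lagrange interpolation turns the logarithmic derivative of \<open>F\<close> into \<open>F' Z = - F f\<close>. Writing
  \<open>F = T^p + g\<close> and comparing degrees, \<open>h = f + g'\<close> is quadratic and \<open>(T + g) f = - Z h\<close>;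
  differentiating gives \<open>f (f - 1) (f - h) = Z (h' f - h f')\<close>.
  So \<open>f\<close> agrees with \<open>h\<close> on the set \<open>K\<close> where its value is neither \<open>0\<close> nor \<open>1\<close>, and takes each value
  above \<open>1\<close> at most twice. As \<open>f\<close> has mean \<open>1\<close> and at most \<open>(p + 1)/2\<close> zeros, \<open>k = |K|\<close> satisfies
  \<open>k (k + 2) \<le> 2 (p + 1)\<close>. Conversely, let \<open>D\<close> be the monic polynomial with simple roots \<open>K\<close>, so that
  \<open>f (f - 1) D = Z q\<close> with \<open>q\<close> of degree \<open>k + 1\<close>. Eliminating \<open>f'\<close> and \<open>Z\<close> between this identity, its
  derivative and the differential equation leaves \<open>f A + B = 0\<close> with \<open>A \<noteq> 0\<close> and \<open>B\<close> of degree at most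
  \<open>2 k + 4\<close>, so \<open>(p + 1)/2 \<le> 2 k + 4\<close>. No prime above \<open>32\<close> allows both bounds.
\<close>

section \<open>The polynomial \<open>T^p - T\<close> and interpolation over the whole field\<close>

definition field_poly :: "'p::prime_card mod_ring poly" where
  "field_poly = monom 1 CARD('p) - [:0, 1:]"

lemma of_nat_mod_ring_neq_0:
  assumes "0 < n" "n < CARD('p::prime_card)"
  shows "(of_nat n :: 'p mod_ring) \<noteq> 0"
  using assms of_nat_0_mod_ring_dvd[where 'a='p, of n] nat_dvd_not_less by blast

lemma to_int_mod_ring_nonneg: "to_int_mod_ring (a :: 'p::prime_card mod_ring) \<ge> 0"
  using range_to_int_mod_ring[where 'a='p] by (metis atLeastLessThan_iff rangeI)

lemma of_nat_to_int_mod_ring: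
  "(of_nat (nat (to_int_mod_ring a)) :: 'p::prime_card mod_ring) = a"
  by (simp add: of_nat_of_int_mod_ring to_int_mod_ring_nonneg)

lemma degree_field_poly: "degree (field_poly :: 'p::prime_card mod_ring poly) = CARD('p)"
proof -
  have "degree ([:0, 1:] :: 'p mod_ring poly) < degree (monom (1 :: 'p mod_ring) CARD('p))"
    using prime_card[where 'a='p] prime_gt_1_nat by (simp add: degree_monom_eq)
  then show ?thesis
    unfolding field_poly_def by (simp add: degree_minus_eq_right degree_monom_eq)
qed

lemma field_poly_neq_0: "(field_poly :: 'p::prime_card mod_ring poly) \<noteq> 0"
  using degree_field_poly[where 'p='p] by auto

lemma poly_field_poly: "poly (field_poly :: 'p::prime_card mod_ring poly) x = 0"
  by (simp add: field_poly_def poly_monom)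

lemma pderiv_field_poly: "pderiv (field_poly :: 'p::prime_card mod_ring poly) = -1"
  by (simp add: field_poly_def pderiv_diff pderiv_monom pderiv_pCons)

lemma degree_prod_linear: "degree (\<Prod>x\<in>A. [:- x, 1:] :: 'a::idom poly) = card A"
  by (subst degree_prod_sum_eq) auto

lemma field_poly_eq_prod:
  "(field_poly :: 'p::prime_card mod_ring poly) = (\<Prod>x\<in>UNIV. [:- x, 1:])"
  using poly_monom_identity_mod_p[where 'a='p] by (simp add: field_poly_def monom_Suc)

lemma field_poly_dvd:
  fixes a :: "'p::prime_card mod_ring poly"
  assumes "\<And>x. poly a x = 0"
  shows "field_poly dvd a"
proof -
  have "a mod field_poly = 0"
  proof (rule poly_eqI_degree[where A = UNIV])
    fix x :: "'p mod_ring"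
    have "poly a x = poly (a div field_poly * field_poly + a mod field_poly) x"
      by simp
    also have "\<dots> = poly (a mod field_poly) x"
      unfolding poly_add poly_mult by (simp add: poly_field_poly)
    finally show "poly (a mod field_poly) x = poly 0 x"
      using assms by simp
  next
    show "degree (a mod field_poly) < card (UNIV :: 'p mod_ring set)"
      using degree_mod_less[OF field_poly_neq_0, of a] degree_field_poly[where 'p='p]
      by fastforce
  qed auto
  then show ?thesis by blast
qed

text \<open>At \<open>z\<close> only the summand \<open>x = z\<close> survives, and its product is
  the derivative of \<open>field_poly\<close> at \<open>z\<close>, which is \<open>-1\<close>; hence
  the sign. Both sides have degree below \<open>p\<close> and agree at \<open>p\<close>
  points.\<close>

lemma lagrange_interpolation_field:
  fixes f :: "'p::prime_card mod_ring poly"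
  assumes "degree f < CARD('p)"
  shows "(\<Sum>x\<in>UNIV. smult (poly f x) (\<Prod>y\<in>UNIV - {x}. [:- y, 1:])) = - f"
proof (rule poly_eqI_degree[where A = UNIV])
  fix z :: "'p mod_ring"
  have "poly (pderiv field_poly) z = -1"
    by (simp add: pderiv_field_poly)
  moreover have "poly (pderiv field_poly) z = (\<Sum>x\<in>UNIV. \<Prod>y\<in>UNIV - {x}. z - y)"
    unfolding field_poly_eq_prod pderiv_prod
    by (simp add: poly_sum poly_prod pderiv_pCons)
  moreover have vanish: "(\<Prod>y\<in>UNIV - {x}. z - y) = 0" if "x \<noteq> z" for x
    using that by (intro prod_zero) auto
  then have "(\<Sum>x\<in>UNIV. \<Prod>y\<in>UNIV - {x}. z - y) = (\<Prod>y\<in>UNIV - {z}. z - y)"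
    by (subst sum.remove[of _ z]) (simp_all add: sum.neutral)
  ultimately have own: "(\<Prod>y\<in>UNIV - {z}. z - y) = -1"
    by simp
  show "poly (\<Sum>x\<in>UNIV. smult (poly f x) (\<Prod>y\<in>UNIV - {x}. [:- y, 1:])) z = poly (- f) z"
    using own by (simp add: poly_sum poly_prod)
      (subst sum.remove[of _ z]; simp add: vanish sum.neutral)
next
  have "degree (\<Sum>x\<in>UNIV. smult (poly f x) (\<Prod>y\<in>UNIV - {x}. [:- y, 1:])) \<le> CARD('p) - 1"
    by (intro degree_sum_le order.trans[OF degree_smult_le]) (auto simp only: degree_prod_linear, auto)
  then show "degree (\<Sum>x\<in>UNIV. smult (poly f x) (\<Prod>y\<in>UNIV - {x}. [:- y, 1:]))
      < card (UNIV :: 'p mod_ring set)"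
    using prime_card[where 'a='p] prime_gt_1_nat[of "CARD('p)"] by simp
qed (use assms in simp)

section \<open>Logarithmic derivative and the differential equation for \<open>f\<close>\<close>

text \<open>The logarithmic derivative with denominators cleared: differentiating
  \<open>[:- x, 1:] ^ m x\<close> costs one linear factor, which \<open>field_poly\<close> gives
  back.\<close>

lemma pderiv_prod_linear_powers:
  fixes m :: "'p::prime_card mod_ring \<Rightarrow> nat"
  shows "pderiv (\<Prod>x\<in>UNIV. [:- x, 1:] ^ m x) * field_poly
    = (\<Prod>x\<in>UNIV. [:- x, 1:] ^ m x) *
      (\<Sum>x\<in>UNIV. smult (of_nat (m x)) (\<Prod>y\<in>UNIV - {x}. [:- y, 1:]))"
proof -
  have summand: "(\<Prod>y\<in>UNIV - {x}. [:- y, 1:] ^ m y) * pderiv ([:- x, 1:] ^ m x) * field_poly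
      = (\<Prod>x\<in>UNIV. [:- x, 1:] ^ m x) *
        smult (of_nat (m x)) (\<Prod>y\<in>UNIV - {x}. [:- y, 1:])" for x :: "'p mod_ring"
  proof (cases "m x")
    case 0
    then show ?thesis by simp
  next
    case (Suc n)
    have F: "(\<Prod>x\<in>UNIV. [:- x, 1:] ^ m x)
        = [:- x, 1:] ^ m x * (\<Prod>y\<in>UNIV - {x}. [:- y, 1:] ^ m y)"
      by (rule prod.remove) auto
    have Z: "field_poly = [:- x, 1:] * (\<Prod>y\<in>UNIV - {x}. [:- y, 1:])"
      unfolding field_poly_eq_prod by (rule prod.remove) auto
    have d: "pderiv ([:- x, 1:] ^ m x) = smult (of_nat (m x)) ([:- x, 1:] ^ n)"
      unfolding pderiv_power by (simp add: Suc pderiv_pCons)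
    have p: "[:- x, 1:] ^ m x = [:- x, 1:] * [:- x, 1:] ^ n"
      by (simp add: Suc)
    show ?thesis
      unfolding F Z d unfolding p by (simp only: mult_smult_left mult_smult_right mult_ac)
  qed
  show ?thesis
    unfolding pderiv_prod sum_distrib_right sum_distrib_left summand ..
qed

text \<open>A positive degree below \<open>p\<close> is nonzero in the field, so the leading term
  survives differentiation.\<close>

lemma degree_pderiv_mod_ring:
  fixes g :: "'p::prime_card mod_ring poly"
  assumes "degree g < CARD('p)"
  shows "degree (pderiv g) = degree g - 1"
proof (cases "degree g")
  case 0
  then obtain c where "g = [:c:]" by (rule degree_eq_zeroE)
  then show ?thesis by simp
next
  case (Suc n)
  have "coeff (pderiv g) n \<noteq> 0"
    using of_nat_mod_ring_neq_0[where 'p='p, of "Suc n"] assms Suc leading_coeff_0_iff[of g]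
    by (auto simp: coeff_pderiv simp del: of_nat_Suc leading_coeff_0_iff)
  then have "n \<le> degree (pderiv g)"
    by (rule le_degree)
  moreover have "degree (pderiv g) \<le> n"
    using Suc by (intro degree_le) (auto simp: coeff_pderiv coeff_eq_0)
  ultimately show ?thesis using Suc by simp
qed

lemma quadratic_companion:
  fixes f :: "'p::prime_card mod_ring poly"
  assumes deg: "degree f = (CARD('p) + 1) div 2" and rs: "range_sum f = int CARD('p)"
    and odd: "odd CARD('p)" and gt: "CARD('p) > 3"
  obtains h where "degree h = 2"
    "f * (f - 1) * (f - h) = field_poly * (pderiv h * f - h * pderiv f)"
proof -
  define m where "m x = nat (to_int_mod_ring (poly f x))" for x
  define F where "F = (\<Prod>x\<in>UNIV. [:- x, 1:] ^ m x)"
  have deg_f: "2 * degree f = CARD('p) + 1" "degree f < CARD('p)"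
    using deg odd gt by (auto elim!: oddE)
  have f0: "f \<noteq> 0"
    using deg_f by auto
  have "int (\<Sum>x\<in>UNIV. m x) = int CARD('p)"
    using rs by (simp add: m_def range_sum_def to_int_mod_ring_nonneg)
  moreover have "degree F = (\<Sum>x\<in>UNIV. m x)"
    unfolding F_def by (subst degree_prod_sum_eq) (auto simp only: degree_linear_power, auto)
  ultimately have deg_F: "degree F = CARD('p)"
    by linarith
  have lc_F: "lead_coeff F = 1"
    by (simp add: F_def lead_coeff_prod lead_coeff_power)
  have F_ode: "pderiv F * field_poly = - (F * f)"
    using pderiv_prod_linear_powers[of m] lagrange_interpolation_field[OF deg_f(2)]
    by (simp add: F_def m_def of_nat_to_int_mod_ring)

  define g where "g = F - monom 1 CARD('p)"
  have "degree g \<le> CARD('p) - 1"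
  proof (rule degree_le, intro allI impI)
    fix i assume "i > CARD('p) - 1"
    then show "coeff g i = 0"
      using deg_F lc_F by (cases "i = CARD('p)") (auto simp: g_def coeff_eq_0)
  qed
  then have deg_g_less: "degree g < CARD('p)"
    using gt by linarith
  have F_g: "F = monom 1 CARD('p) + g"
    by (simp add: g_def)
  \<comment> \<open>In characteristic \<open>p\<close> the leading term \<open>T^p\<close> has
    derivative zero.\<close>
  have dF: "pderiv F = pderiv g"
    by (simp add: F_g pderiv_add pderiv_monom)
  have F0: "F \<noteq> 0"
    using lc_F by auto
  have dg0: "pderiv g \<noteq> 0"
    using F_ode F0 f0 dF by auto
  have "degree (pderiv F * field_poly) = degree (F * f)"
    by (simp add: F_ode)
  then have deg_dg: "degree (pderiv g) = degree f"
    using F0 f0 dg0 deg_F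
    by (simp add: dF degree_mult_eq degree_field_poly field_poly_neq_0)
  then have deg_g: "degree g = degree f + 1"
    using degree_pderiv_mod_ring[OF deg_g_less] deg_f gt by linarith

  define h where "h = f + pderiv g"
  \<comment> \<open>Collecting the multiples of \<open>T^p\<close> in \<open>F_ode\<close> isolates
    \<open>h\<close>. On the right \<open>g * f\<close> dominates with degree
    \<open>(p + 3)/2 + (p + 1)/2 = p + 2\<close>, which leaves degree 2 for
    \<open>h\<close>.\<close>
  have h_eq: "monom 1 CARD('p) * h = [:0, 1:] * pderiv g - g * f"
  proof -
    have "monom 1 CARD('p) * h
        = (pderiv F * field_poly + F * f) + ([:0, 1:] * pderiv g - g * f)"
      unfolding dF unfolding F_g h_def field_poly_def by (simp only: algebra_simps)
    then show ?thesis by (simp add: F_ode)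
  qed
  have "degree (g * f) = CARD('p) + 2"
    using deg_g deg_f f0 by (subst degree_mult_eq) auto
  moreover have "degree ([:0, 1:] * pderiv g) < CARD('p) + 2"
    using deg_dg deg_f gt dg0 by (subst degree_mult_eq) auto
  ultimately have "degree (monom 1 CARD('p) * h) = CARD('p) + 2"
    unfolding h_eq using degree_minus_eq_right degree_minus minus_diff_eq by metis
  moreover from this have "h \<noteq> 0" by auto
  ultimately have "degree h = 2"
    by (simp add: degree_mult_eq degree_monom_eq)

  \<comment> \<open>This is \<open>F - field_poly\<close>, the remainder of \<open>F\<close> modulo
    \<open>field_poly\<close>.\<close>
  define u where "u = [:0, 1:] + g"
  have u_f: "u * f = - (field_poly * h)"
  proof -
    have "u * f = [:0, 1:] * h - ([:0, 1:] * pderiv g - g * f)"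
      unfolding u_def h_def by (simp only: algebra_simps)
    then show ?thesis
      unfolding h_eq[symmetric] field_poly_def by (simp only: left_diff_distrib minus_diff_eq)
  qed
  have u': "pderiv u = 1 + h - f"
    by (simp add: u_def pderiv_add pderiv_pCons h_def)
  have "pderiv (u * f) = - pderiv (field_poly * h)"
    unfolding u_f by (rule pderiv_minus)
  then have du: "f * (1 + h - f) = h - field_poly * pderiv h - u * pderiv f"
    unfolding u'[symmetric] by (simp add: pderiv_mult pderiv_field_poly algebra_simps)
  \<comment> \<open>Multiplying \<open>du\<close> by \<open>f\<close> makes \<open>u\<close> occur
    only in \<open>u * f\<close>, which \<open>u_f\<close> replaces by a multiple of
    \<open>field_poly\<close>.\<close>
  have "f * (f - 1) * (f - h) = f * h - f * (f * (1 + h - f))"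
    by (simp add: algebra_simps)
  also have "\<dots> = f * field_poly * pderiv h + (u * f) * pderiv f"
    unfolding du by (simp add: algebra_simps)
  also have "\<dots> = field_poly * (pderiv h * f - h * pderiv f)"
    unfolding u_f by (simp add: algebra_simps)
  finally have "f * (f - 1) * (f - h) = field_poly * (pderiv h * f - h * pderiv f)" .
  with \<open>degree h = 2\<close> show thesis by (rule that)
qed

section \<open>Two opposing bounds on the size of \<open>K\<close>\<close>

text \<open>Pure algebra with the primed letters as free variables. Comparing \<open>e1\<close> with
  \<open>e2\<close> cancels \<open>Z\<close> and expresses \<open>D * h * f'\<close>; multiplying
  \<open>e3\<close> by \<open>q\<close> turns its \<open>Z * q\<close> into
  \<open>f * (f - 1) * D\<close>. Substitution gives a quadratic in \<open>f\<close> whose constant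
  terms \<open>- h * q\<^sup>2\<close> and \<open>h * q\<^sup>2\<close> cancel, so a factor
  \<open>f\<close> drops out and a linear relation remains.\<close>

lemma eliminate_derivative:
  fixes Z f h q D f' h' q' D' :: "'a::idom"
  assumes "Z \<noteq> 0" "f \<noteq> 0"
    and e1: "f * (f - 1) * (f - h) = Z * (h' * f - h * f')"
    and e2: "f * (f - 1) * D = Z * q"
    and e3: "f' * (2 * f - 1) * D + f * (f - 1) * D' = Z * q' - q"
  shows "f * (2 * q * D * h' - 2 * q\<^sup>2 + q * h * D' - h * q' * D)
    + (2 * h * q\<^sup>2 + q\<^sup>2 - q * D * h' - q * h * D' + h * q' * D) = 0" (is "?L = 0")
proof -
  have "Z * (q * (f - h)) = D * (f * (f - 1) * (f - h))"
    unfolding mult.assoc[symmetric] e2[symmetric] by (simp only: mult_ac)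
  also have "\<dots> = Z * (D * (h' * f - h * f'))"
    unfolding e1 by (rule mult.left_commute)
  finally have "q * (f - h) = D * (h' * f - h * f')"
    using \<open>Z \<noteq> 0\<close> by simp
  then have e4: "D * h' * f - q * (f - h) = D * h * f'"
    by (simp add: algebra_simps)
  have e5: "q * (f' * (2 * f - 1) * D + f * (f - 1) * D') = f * (f - 1) * D * q' - q\<^sup>2"
    unfolding e2 e3 by (simp add: algebra_simps power2_eq_square)
  have "f * ?L = q * (2 * f - 1) * (D * h' * f - q * (f - h)) + h * q * f * (f - 1) * D'
      - h * (f * (f - 1) * D * q' - q\<^sup>2)"
    by (simp add: algebra_simps power2_eq_square)
  also have "\<dots> = h * (q * (f' * (2 * f - 1) * D + f * (f - 1) * D'))
      - h * (f * (f - 1) * D * q' - q\<^sup>2)"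
    unfolding e4 by (simp add: algebra_simps)
  also have "\<dots> = 0"
    unfolding e5 by simp
  finally show ?thesis using \<open>f \<noteq> 0\<close> by simp
qed

text \<open>The extremal weights are 1, 1, 2, 2, 3, 3 and so on. The induction removes an element of
  largest weight \<open>M\<close>, and \<open>card K \<le> 2 * M\<close> because only
  \<open>M\<close> values are available.\<close>

lemma sum_ge_if_fibres_card_le_2:
  fixes w :: "'a \<Rightarrow> nat"
  assumes "finite K" "\<And>x. x \<in> K \<Longrightarrow> w x \<ge> 1"
    and "\<And>v. card {x \<in> K. w x = v} \<le> 2"
  shows "card K * (card K + 2) \<le> 4 * sum w K"
  using assms
proof (induction "card K" arbitrary: K)
  case 0
  then show ?case by simp
next
  case (Suc n)
  define M where "M = Max (w ` K)"
  have "K \<noteq> {}" using Suc.hyps(2) by auto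
  then have "M \<in> w ` K"
    unfolding M_def using Suc.prems(1) by (intro Max_in) auto
  then obtain x where x: "x \<in> K" "w x = M" by blast
  have "w y \<in> {1..M}" if "y \<in> K" for y
    using that Suc.prems(1,2) by (auto simp: M_def)
  then have "K = (\<Union>v\<in>{1..M}. {y \<in> K. w y = v})" by blast
  then have "card K \<le> (\<Sum>v\<in>{1..M}. card {y \<in> K. w y = v})"
    using card_UN_le[of "{1..M}" "\<lambda>v. {y \<in> K. w y = v}"] by simp
  also have "\<dots> \<le> (\<Sum>v\<in>{1..M}. 2)"
    by (intro sum_mono Suc.prems(3))
  finally have M: "Suc n \<le> 2 * M"
    using Suc.hyps(2) by simp
  have "card (K - {x}) * (card (K - {x}) + 2) \<le> 4 * sum w (K - {x})"
  proof (rule Suc.hyps(1))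
    show "n = card (K - {x})" using x Suc.hyps(2) Suc.prems(1) by simp
    show "card {y \<in> K - {x}. w y = v} \<le> 2" for v
      using Suc.prems(1) by (intro order.trans[OF card_mono Suc.prems(3)[of v]]) auto
  qed (use Suc.prems in auto)
  moreover have "card (K - {x}) = n" using x Suc.hyps(2) Suc.prems(1) by simp
  moreover have "sum w K = M + sum w (K - {x})"
    using x Suc.prems(1) by (simp add: sum.remove)
  ultimately have step: "n * (n + 2) + 4 * M \<le> 4 * sum w K" by simp
  show ?case
  proof (cases "even n")
    case True
    then have "Suc n + 1 \<le> 2 * M" using M by presburger
    then show ?thesis using step unfolding Suc.hyps(2)[symmetric] by (simp add: algebra_simps)
  next
    case False
    then obtain j where j: "n = 2 * j + 1" by (rule oddE)
    \<comment> \<open>This is one short of the target \<open>4 * (j * j) + 12 * j + 8\<close>;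
      divisibility of the right side by 4 makes up the difference.\<close>
    have "4 * (j * j) + 12 * j + 7 \<le> 4 * sum w K"
      using step M by (simp add: j algebra_simps)
    then have "j * j + 3 * j + 2 \<le> sum w K" by presburger
    then show ?thesis unfolding Suc.hyps(2)[symmetric] j by (simp add: algebra_simps)
  qed
qed

lemma degree_le_2_card_exceptional:
  fixes f h :: "'p::prime_card mod_ring poly"
  assumes gt: "CARD('p) > 2" and f: "2 * degree f = CARD('p) + 1" and h: "degree h = 2"
    and ode: "f * (f - 1) * (f - h) = field_poly * (pderiv h * f - h * pderiv f)"
  shows "degree f \<le> 2 * card {x. poly f x \<notin> {0, 1}} + 4"
proof -
  define K where "K = {x. poly f x \<notin> {0, 1}}"
  define k where "k = card K"
  define D where "D = (\<Prod>x\<in>K. [:- x, 1:])"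
  have deg_D: "degree D = k" "D \<noteq> 0"
    unfolding D_def k_def by (rule degree_prod_linear) auto
  have f0: "f \<noteq> 0" "f - 1 \<noteq> 0" using f gt by auto
  have deg_f1: "degree (f - 1) = degree f"
    using f gt by (intro degree_minus_eq_right) auto
  have "field_poly dvd f * (f - 1) * D"
  proof (rule field_poly_dvd)
    fix x
    have "poly D x = 0" if "x \<in> K"
      using that by (auto simp: D_def poly_prod)
    then show "poly (f * (f - 1) * D) x = 0"
      by (auto simp: K_def)
  qed
  then obtain q where q: "f * (f - 1) * D = field_poly * q" ..
  then have q0: "q \<noteq> 0" using f0 deg_D(2) by auto
  have "degree (f * (f - 1) * D) = degree (field_poly * q)" by (simp add: q)
  \<comment> \<open>The factor \<open>f * (f - 1)\<close> has degree \<open>p + 1\<close> and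
    \<open>D\<close> has degree \<open>k\<close>; \<open>field_poly\<close> takes away
    \<open>p\<close>.\<close>
  then have deg_q: "degree q = k + 1"
    using f0 deg_D q0 f deg_f1
    by (simp add: degree_mult_eq degree_field_poly field_poly_neq_0)
  have "pderiv (f * (f - 1) * D) = pderiv (field_poly * q)" by (simp add: q)
  then have dq: "pderiv f * (2 * f - 1) * D + f * (f - 1) * pderiv D = field_poly * pderiv q - q"
    by (simp add: pderiv_mult pderiv_diff pderiv_field_poly algebra_simps)
  define A where "A = 2 * q * D * pderiv h - 2 * q\<^sup>2 + q * h * pderiv D - h * pderiv q * D"
  define B where
    "B = 2 * h * q\<^sup>2 + q\<^sup>2 - q * D * pderiv h - q * h * pderiv D + h * pderiv q * D"
  have AB: "f * A + B = 0"
    unfolding A_def B_def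
    by (rule eliminate_derivative[OF field_poly_neq_0 f0(1) ode q dq])
  have dh: "degree (pderiv h) = 1"
    using degree_pderiv_mod_ring[of h] h gt by simp
  have two: "(2 :: 'p mod_ring) \<noteq> 0"
    using of_nat_mod_ring_neq_0[where 'p='p, of 2] gt by simp
  \<comment> \<open>If \<open>A\<close> vanished, so would \<open>B\<close>. In \<open>A + B\<close>
    the terms with \<open>pderiv D\<close> and \<open>pderiv q\<close> cancel and a factor
    \<open>q\<close> comes out, leaving two products of degrees \<open>k + 3\<close> and at most
    \<open>k + 1\<close> that cannot cancel.\<close>
  have "A \<noteq> 0"
  proof
    assume "A = 0"
    then have "A + B = 0" using AB by simp
    moreover have "A + B = q * ((2 * h - 1) * q + D * pderiv h)"
      unfolding A_def B_def by (simp add: algebra_simps power2_eq_square)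
    ultimately have eq: "(2 * h - 1) * q = - (D * pderiv h)"
      using q0 by (simp add: add_eq_0_iff2)
    have "degree (2 * h) = 2"
      using h two by (simp add: numeral_poly)
    then have "degree (2 * h - 1) = 2"
      by (subst degree_minus_eq_right) auto
    then have "degree ((2 * h - 1) * q) = k + 3"
      using q0 deg_q by (subst degree_mult_eq) auto
    moreover have "degree (D * pderiv h) \<le> k + 1"
      using degree_mult_le[of D "pderiv h"] deg_D dh by simp
    ultimately show False by (simp add: eq)
  qed
  have "degree B \<le> 2 * k + 4"
  proof -
    have "degree (pderiv D) \<le> k" "degree (pderiv q) \<le> k"
      using degree_pderiv_le[of D] degree_pderiv_le[of q] deg_D deg_q by auto
    then have b: "degree (2 * h * q\<^sup>2) \<le> 2 * k + 4" "degree (q\<^sup>2) \<le> 2 * k + 4"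
      "degree (q * D * pderiv h) \<le> 2 * k + 4" "degree (q * h * pderiv D) \<le> 2 * k + 4"
      "degree (h * pderiv q * D) \<le> 2 * k + 4"
      using deg_D deg_q dh h
      by (auto simp: power2_eq_square numeral_poly intro!: order.trans[OF degree_mult_le]
          order.trans[OF add_mono[OF degree_mult_le order.refl]])
    then show ?thesis
      unfolding B_def by (intro degree_add_le degree_diff_le)
  qed
  moreover have "degree (f * A) = degree B"
    using AB by (metis add_eq_0_iff degree_minus)
  ultimately show ?thesis
    using \<open>A \<noteq> 0\<close> f0 by (simp add: degree_mult_eq k_def K_def)
qed

section \<open>Contradiction between the two bounds\<close>

theorem theorem1:
  assumes "CARD('p::prime_card) > 32"
  shows "\<not> (\<exists>f :: 'p mod_ring poly.
            degree f = (CARD('p) + 1) div 2 \<and> range_sum f = int CARD('p))"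
proof
  assume "\<exists>f :: 'p mod_ring poly.
            degree f = (CARD('p) + 1) div 2 \<and> range_sum f = int CARD('p)"
  then obtain f :: "'p mod_ring poly"
    where deg: "degree f = (CARD('p) + 1) div 2" and rs: "range_sum f = int CARD('p)"
    by blast
  have p: "prime CARD('p)" by (rule prime_card)
  then have odd: "odd CARD('p)"
    using assms prime_odd_nat by auto
  then have deg2: "2 * degree f = CARD('p) + 1"
    by (simp add: deg)
  then have f0: "f \<noteq> 0" by auto
  obtain h where h: "degree h = 2"
    and ode: "f * (f - 1) * (f - h) = field_poly * (pderiv h * f - h * pderiv f)"
    by (rule quadratic_companion[OF deg rs odd]) (use assms in auto)
  define K where "K = {x. poly f x \<notin> {0, 1}}"
  define w where "w x = to_int_mod_ring (poly f x)" for x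
  have w_ge: "w x \<ge> 0" for x
    by (simp add: w_def to_int_mod_ring_nonneg)
  have w_0: "w x = 0 \<longleftrightarrow> poly f x = 0" for x
    unfolding w_def using to_int_mod_ring_hom.hom_0_iff by blast
  have w_1: "w x = 1 \<longleftrightarrow> poly f x = 1" for x
    unfolding w_def using to_int_mod_ring_hom.hom_1_iff by blast
  have w_K: "w x \<ge> 2" if "x \<in> K" for x
    using that w_ge[of x] w_0[of x] w_1[of x] by (auto simp: K_def)

  \<comment> \<open>The shift by 1 makes the weights start at 1 on \<open>K\<close>. A fibre
    consists of roots of the quadratic \<open>h - [:c:]\<close>, since \<open>f\<close> agrees with
    \<open>h\<close> on \<open>K\<close>.\<close>
  have "card K * (card K + 2) \<le> 4 * (\<Sum>x\<in>K. nat (w x - 1))"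
  proof (rule sum_ge_if_fibres_card_le_2)
    show "nat (w x - 1) \<ge> 1" if "x \<in> K" for x
      using w_K[OF that] by simp
    fix v
    show "card {x \<in> K. nat (w x - 1) = v} \<le> 2"
    proof -
      define c :: "'p mod_ring" where "c = of_nat (v + 1)"
      have "poly (h - [:c:]) x = 0" if "x \<in> K" "nat (w x - 1) = v" for x
      proof -
        have "poly (f * (f - 1) * (f - h)) x = 0"
          by (simp add: ode poly_field_poly)
        then have "poly f x = poly h x"
          using that(1) by (auto simp: K_def)
        moreover have "nat (w x) = v + 1"
          using that w_K[of x] by simp
        then have "poly f x = c"
          using of_nat_to_int_mod_ring[of "poly f x"] by (simp add: w_def c_def)
        ultimately show ?thesis by simp
      qed
      moreover have deg_hc: "degree (h - [:c:]) = 2"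
        using h by (subst degree_minus_eq_right) auto
      ultimately have "card {x \<in> K. nat (w x - 1) = v} \<le> card {x. poly (h - [:c:]) x = 0}"
        by (intro card_mono) auto
      also have "\<dots> \<le> 2"
        using card_poly_roots_bound[of "h - [:c:]"] deg_hc by fastforce
      finally show ?thesis .
    qed
  qed auto
  \<comment> \<open>The range sum makes \<open>w - 1\<close> sum to zero over the field. Points of
    value 1 contribute nothing and each zero of \<open>f\<close> contributes \<open>-1\<close>, so
    the sum over \<open>K\<close> counts the zeros of \<open>f\<close>.\<close>
  moreover have "(\<Sum>x\<in>K. nat (w x - 1)) \<le> degree f"
  proof -
    let ?N = "{x. poly f x = 0}"
    have "(\<Sum>x\<in>UNIV. w x - 1) = 0"
      using rs by (simp add: range_sum_def w_def sum_subtractf)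
    moreover have "(\<Sum>x\<in>UNIV. w x - 1) = (\<Sum>x\<in>K \<union> ?N. w x - 1)"
      using w_1 by (intro sum.mono_neutral_right) (auto simp: K_def)
    moreover have "\<dots> = (\<Sum>x\<in>K. w x - 1) + (\<Sum>x\<in>?N. w x - 1)"
      by (intro sum.union_disjoint) (auto simp: K_def)
    moreover have "(\<Sum>x\<in>?N. w x - 1) = - int (card ?N)"
      by (simp add: w_0[THEN iffD2])
    moreover have "(\<Sum>x\<in>K. w x - 1) = int (\<Sum>x\<in>K. nat (w x - 1))"
      using w_K by (force intro!: sum.cong)
    ultimately show ?thesis
      using card_poly_roots_bound[OF f0] by linarith
  qed
  ultimately have lower: "card K * (card K + 2) \<le> 4 * degree f" by linarith
  have upper: "degree f \<le> 2 * card K + 4"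
    unfolding K_def using degree_le_2_card_exceptional[OF _ deg2 h ode] assms by simp
  \<comment> \<open>With \<open>k = card K\<close>, the bounds give
    \<open>k (k + 2) \<le> 8 k + 16\<close>, that is \<open>(k - 8) (k + 2) \<le> 0\<close>.\<close>
  have "card K \<le> 8"
  proof (rule ccontr)
    assume "\<not> card K \<le> 8"
    then obtain j where "card K = 9 + j" using le_Suc_ex[of 9 "card K"] by auto
    then show False using lower upper by (simp add: algebra_simps)
  qed
  then have "degree f \<le> 20" using upper by simp
  then have "CARD('p) = 33 \<or> CARD('p) = 35 \<or> CARD('p) = 37 \<or> CARD('p) = 39"
    using deg2 assms by presburger
  moreover have "\<not> prime (33::nat)" "\<not> prime (35::nat)" "\<not> prime (39::nat)"
    by simp_all
  \<comment> \<open>Only \<open>p = 37\<close> survives. It forces \<open>k = 8\<close>, and then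
    \<open>80 \<le> 76\<close> is the contradiction.\<close>
  ultimately have "degree f = 19"
    using p deg2 by auto
  moreover from this have "card K = 8"
    using upper \<open>card K \<le> 8\<close> by linarith
  ultimately show False using lower by simp
qed

end
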